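(* Given a prime number $q$, there is a positive integer $t$ for which there exist $2^t$ mutually quasi-unbiased Hadamard matrices for the parameters $(2^{2t}q,\,2^{2t}q,\,2^{2t},\,2^{2t}q^2)$; that is, there are Hadamard matrices $H_1,\ldots,H_{2^t}$ of order $2^{2t}q$ such that for all distinct $i,j$, $\frac{1}{2^tq}H_iH_j^\top$ is a weighing matrix of order $2^{2t}q$ and weight $2^{2t}$.
   Context: A Hadamard matrix of order $n$ is an $n\times n$ $(1,-1)$-matrix $H$ with $HH^\top=nI_n$. A weighing matrix of order $n$ and weight $k$ is an $n\times n$ $(0,1,-1)$-matrix $W$ with $WW^\top=kI_n$. Two weighing matrices $W_1,W_2$ of order $n$ and weight $k$ are quasi-unbiased for parameters $(n,k,l,a)$ if $\frac1{\sqrt a}W_1W_2^\top$ is a weighing matrix of order $n$ and weight $l$; a family is mutually quasi-unbiased if any two distinct members are. *)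

theory Defs
  imports Complex_Main "HOL-Computational_Algebra.Primes"
begin

text \<open>Square matrices of order n are represented as functions nat => nat => real,
  only the entries with indices in {0..<n} being relevant.\<close>

definition mat_mult :: "nat \<Rightarrow> (nat \<Rightarrow> nat \<Rightarrow> real) \<Rightarrow> (nat \<Rightarrow> nat \<Rightarrow> real) \<Rightarrow> (nat \<Rightarrow> nat \<Rightarrow> real)" where
  "mat_mult n A B = (\<lambda>i j. \<Sum>l<n. A i l * B l j)"

definition mat_transpose :: "(nat \<Rightarrow> nat \<Rightarrow> real) \<Rightarrow> (nat \<Rightarrow> nat \<Rightarrow> real)" where
  "mat_transpose A = (\<lambda>i j. A j i)"

definition mat_scale :: "real \<Rightarrow> (nat \<Rightarrow> nat \<Rightarrow> real) \<Rightarrow> (nat \<Rightarrow> nat \<Rightarrow> real)" where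
  "mat_scale c A = (\<lambda>i j. c * A i j)"

definition weighing_matrix :: "nat \<Rightarrow> nat \<Rightarrow> (nat \<Rightarrow> nat \<Rightarrow> real) \<Rightarrow> bool" where
  "weighing_matrix n k W \<longleftrightarrow>
     (\<forall>i<n. \<forall>j<n. W i j \<in> {0, 1, -1}) \<and>
     (\<forall>i<n. \<forall>j<n. mat_mult n W (mat_transpose W) i j = (if i = j then real k else 0))"

definition hadamard_matrix :: "nat \<Rightarrow> (nat \<Rightarrow> nat \<Rightarrow> real) \<Rightarrow> bool" where
  "hadamard_matrix n H \<longleftrightarrow>
     (\<forall>i<n. \<forall>j<n. H i j \<in> {1, -1}) \<and>
     (\<forall>i<n. \<forall>j<n. mat_mult n H (mat_transpose H) i j = (if i = j then real n else 0))"

definition quasi_unbiased :: "nat \<Rightarrow> nat \<Rightarrow> nat \<Rightarrow> nat \<Rightarrow> (nat \<Rightarrow> nat \<Rightarrow> real) \<Rightarrow> (nat \<Rightarrow> nat \<Rightarrow> real) \<Rightarrow> bool" where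
  "quasi_unbiased n k l a W1 W2 \<longleftrightarrow>
     weighing_matrix n k W1 \<and> weighing_matrix n k W2 \<and>
     weighing_matrix n l (mat_scale (1 / sqrt (real a)) (mat_mult n W1 (mat_transpose W2)))"

end

theory Submission
  imports Defs
    "HOL-Library.Z2"
    "HOL-Number_Theory.Euler_Criterion"
    "HOL-Algebra.Algebraic_Closure_Type"
    "Jordan_Normal_Form.Determinant"
begin

hide_const (open) Divisibility.prime

text \<open>
  There is a Hadamard matrix \<open>S\<close> of order \<open>2 ^ t * q\<close> for some \<open>t > 0\<close>: a suitable multiset of
  \<open>2 ^ k\<close> pairwise amicable \<open>\<plusminus>1\<close> matrices of order \<open>q\<close>, taken among \<open>J\<close>, \<open>J - 2I\<close> and two matrices built
  from the quadratic character, has Gram matrices summing to \<open>2 ^ k * q * I\<close>, and repeatedly merging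
  two of these matrices while doubling the order leaves a single Hadamard matrix.

  Put \<open>n = 2 ^ t\<close>, let \<open>S\<^sub>k\<close> be the \<open>n\<close> chunks of \<open>q\<close> consecutive rows of \<open>S\<close>, and let \<open>c\<^sub>y\<close> be the
  columns of a Hadamard matrix of order \<open>n\<close>. For \<open>a\<close> in the field with \<open>n\<close> elements let \<open>H\<^sub>a\<close> be the block
  matrix whose \<open>(x, y)\<close> block is the tensor product of \<open>c\<^sub>y\<close> and \<open>S\<^sub>k\<close> for \<open>k = x + a * y\<close>. If \<open>a \<noteq> b\<close>, then
  \<open>x + a * y = x' + b * y\<close> has exactly one solution \<open>y\<close>, so every block of the product of \<open>H\<^sub>a\<close> with the transpose of
  \<open>H\<^sub>b\<close> consists of a single term, \<open>n * q\<close> times the tensor product of \<open>c\<^sub>y c\<^sub>y\<^sup>T\<close> and \<open>I\<close>.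
\<close>

subsection \<open>Merging amicable matrices\<close>

definition gram :: "nat \<Rightarrow> (nat \<Rightarrow> nat \<Rightarrow> real) \<Rightarrow> (nat \<Rightarrow> nat \<Rightarrow> real) \<Rightarrow> nat \<Rightarrow> nat \<Rightarrow> real" where
  "gram n A B i j = (\<Sum>l<n. A i l * B j l)"

lemma gram_commute: "gram n A B i j = gram n B A j i"
  by (simp add: gram_def mult.commute)

lemma hadamard_matrix_iff:
  "hadamard_matrix n H \<longleftrightarrow> (\<forall>i<n. \<forall>j<n. H i j \<in> {1, -1}) \<and>
     (\<forall>i<n. \<forall>j<n. gram n H H i j = (if i = j then real n else 0))"
  by (simp add: hadamard_matrix_def gram_def mat_mult_def mat_transpose_def)

text \<open>The blocks of \<open>[[A, B], [C, D]]\<close> are interleaved by parity, which only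
  permutes rows and columns, so the block size does not enter the definition.\<close>

definition block22 :: "(nat \<Rightarrow> nat \<Rightarrow> real) \<Rightarrow> (nat \<Rightarrow> nat \<Rightarrow> real) \<Rightarrow> (nat \<Rightarrow> nat \<Rightarrow> real) \<Rightarrow>
    (nat \<Rightarrow> nat \<Rightarrow> real) \<Rightarrow> nat \<Rightarrow> nat \<Rightarrow> real" where
  "block22 A B C D i j =
     (if even i then if even j then A else B else if even j then C else D) (i div 2) (j div 2)"

lemma sum_lessThan_double: "(\<Sum>l<2 * n. f l) = (\<Sum>l<n. f (2 * l) + f (2 * l + 1))" for f :: "nat \<Rightarrow> real"
  by (induction n) (simp_all add: algebra_simps)

lemma gram_block22:
  "gram (2 * n) (block22 A B C D) (block22 A' B' C' D') i j =
    (if even i then if even j then gram n A A' (i div 2) (j div 2) + gram n B B' (i div 2) (j div 2)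
                    else gram n A C' (i div 2) (j div 2) + gram n B D' (i div 2) (j div 2)
     else if even j then gram n C A' (i div 2) (j div 2) + gram n D B' (i div 2) (j div 2)
                    else gram n C C' (i div 2) (j div 2) + gram n D D' (i div 2) (j div 2))"
  unfolding gram_def sum_lessThan_double by (simp add: block22_def sum.distrib)

lemma gram_uminus [simp]:
  "gram n (\<lambda>i j. - A i j) B i j = - gram n A B i j"
  "gram n A (\<lambda>i j. - B i j) i j = - gram n A B i j"
  by (simp_all add: gram_def sum_negf)

lemma block22_pm1:
  assumes "\<And>i j. i < n \<Longrightarrow> j < n \<Longrightarrow> A i j \<in> {1, -1} \<and> B i j \<in> {1, -1} \<and> C i j \<in> {1, -1} \<and> D i j \<in> {1, -1}"
    and "i < 2 * n" "j < 2 * n"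
  shows "block22 A B C D i j \<in> {1, -1}"
proof -
  have "i div 2 < n" "j div 2 < n" using assms by auto
  from assms(1)[OF this] show ?thesis by (simp add: block22_def)
qed

lemma div2_eq_iff: "i div 2 = j div 2 \<and> (even i \<longleftrightarrow> even j) \<longleftrightarrow> i = j" for i j :: nat
  by (metis bit_eq_rec)

text \<open>Sylvester doubling: in the product with the transpose, the blocks of mixed parity
  cancel.\<close>

lemma hadamard_matrix_double:
  assumes "hadamard_matrix n H"
  shows "hadamard_matrix (2 * n) (block22 H H H (\<lambda>i j. - H i j))"
  unfolding hadamard_matrix_iff
proof (intro conjI allI impI)
  fix i j assume ij: "i < 2 * n" "j < 2 * n"
  show "block22 H H H (\<lambda>i j. - H i j) i j \<in> {1, -1}"
    using assms ij by (intro block22_pm1[of n]) (auto simp: hadamard_matrix_def)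
  have "i div 2 < n" "j div 2 < n" using ij by auto
  then show "gram (2 * n) (block22 H H H (\<lambda>i j. - H i j)) (block22 H H H (\<lambda>i j. - H i j)) i j =
      (if i = j then real (2 * n) else 0)"
    using assms div2_eq_iff[of i j] by (auto simp: gram_block22 hadamard_matrix_iff)
qed

lemma ex_hadamard_matrix_power_2: "\<exists>H. hadamard_matrix (2 ^ t) H"
proof (induction t)
  case 0
  have "hadamard_matrix 1 (\<lambda>_ _. 1)"
    by (simp add: hadamard_matrix_iff gram_def)
  then show ?case by auto
next
  case (Suc t)
  then show ?case using hadamard_matrix_double by auto
qed

text \<open>Two matrices of equal weight are merged into \<open>[[P, Q], [Q, -P]]\<close>, of twice that weight, while
  every other matrix \<open>R\<close> becomes \<open>[[R, R], [-R, R]]\<close>. The resulting matrices are again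
  amicable because \<open>[[x, y], [y, -x]]\<close> and \<open>[[1, 1], [-1, 1]]\<close> are.\<close>
lemma hadamard_matrix_of_amicable:
  fixes P :: "'i \<Rightarrow> nat \<Rightarrow> nat \<Rightarrow> real" and e :: "'i \<Rightarrow> nat"
  assumes "finite I" "card I = Suc m" and "(\<Sum>i\<in>I. 2 ^ e i) = (2::nat) ^ K"
    and "\<And>i x y. i \<in> I \<Longrightarrow> x < n \<Longrightarrow> y < n \<Longrightarrow> P i x y \<in> {1, -1}"
    and "\<And>i j x y. i \<in> I \<Longrightarrow> j \<in> I \<Longrightarrow> x < n \<Longrightarrow> y < n \<Longrightarrow> gram n (P i) (P j) x y = gram n (P j) (P i) x y"
    and "\<And>x y. x < n \<Longrightarrow> y < n \<Longrightarrow>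
      (\<Sum>i\<in>I. 2 ^ e i * gram n (P i) (P i) x y) = (if x = y then 2 ^ K * real n else 0)"
  shows "\<exists>H. hadamard_matrix (2 ^ m * n) H"
  using assms
proof (induction m arbitrary: I P e n)
  case 0
  then obtain i where i: "I = {i}" by (metis One_nat_def card_1_singletonE)
  have "e i = K" using 0(3) i by simp
  then have "hadamard_matrix n (P i)"
    using 0(4) 0(6) i by (fastforce simp: hadamard_matrix_iff split: if_splits)
  then show ?case by auto
next
  case (Suc m)
  define e0 where "e0 = Min (e ` I)"
  have "I \<noteq> {}" using Suc.prems(2) by auto
  then obtain i where i: "i \<in> I" "e i = e0"
    using Suc.prems(1) Min_in[of "e ` I"] unfolding e0_def by fastforce
  have e0: "e0 \<le> e j" if "j \<in> I" for j using that Suc.prems(1) by (simp add: e0_def)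
  \<comment> \<open>Otherwise the total weight would be an odd multiple of \<open>2 ^ e0\<close>.\<close>
  have "\<exists>j\<in>I - {i}. e j = e0"
  proof (rule ccontr)
    assume neg: "\<not> ?thesis"
    have "2 ^ Suc e0 dvd (\<Sum>j\<in>I - {i}. (2::nat) ^ e j)"
    proof (intro dvd_sum le_imp_power_dvd)
      fix j assume "j \<in> I - {i}"
      then show "Suc e0 \<le> e j" using neg e0[of j] by (metis DiffD1 Suc_leI le_neq_implies_less)
    qed
    moreover have split: "(2::nat) ^ K = 2 ^ e0 + (\<Sum>j\<in>I - {i}. 2 ^ e j)"
      using Suc.prems(1,3) i by (metis sum.remove)
    have "card (I - {i}) > 0" using Suc.prems(1,2) i by simp
    then have "I - {i} \<noteq> {}" by fastforce
    then have "(\<Sum>j\<in>I - {i}. (2::nat) ^ e j) > 0" using Suc.prems(1) by (intro sum_pos) auto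
    then have "(2::nat) ^ e0 < 2 ^ K" using split by linarith
    then have "e0 < K" by simp
    then have "2 ^ Suc e0 dvd (2::nat) ^ K" by (intro le_imp_power_dvd) simp
    ultimately have "2 ^ Suc e0 dvd (2::nat) ^ e0" using split by (metis dvd_add_left_iff)
    then show False by (auto dest: dvd_imp_le)
  qed
  then obtain j where j: "j \<in> I" "j \<noteq> i" "e j = e0" by auto
  define I' where "I' = I - {j}"
  \<comment> \<open>As \<open>2 ^ e0 + 2 ^ e0 = 2 ^ Suc e0\<close>, the merged matrix carries the
    weights of both \<open>P i\<close> and \<open>P j\<close>: the total stays \<open>2 ^ K\<close>,
    while the order and the Gram sum double.\<close>
  define e' where "e' = e(i := Suc e0)"
  define P' where "P' = (\<lambda>k. if k = i then block22 (P i) (P j) (P j) (\<lambda>x y. - P i x y)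
    else block22 (P k) (P k) (\<lambda>x y. - P k x y) (P k))"
  have I': "finite I'" "i \<in> I'" "I' \<subseteq> I" using Suc.prems(1) i j by (auto simp: I'_def)
  have am: "gram n (P k) (P l) x y = gram n (P l) (P k) x y"
    if "k \<in> I" "l \<in> I" "x < n" "y < n" for k l x y
    using Suc.prems(5) that by blast
  have "\<exists>H. hadamard_matrix (2 ^ m * (2 * n)) H"
  proof (rule Suc.IH[of I' e' _ P'])
    show "finite I'" by fact
    show "card I' = Suc m" using Suc.prems(1,2) j(1) by (simp add: I'_def)
    have rem: "(\<Sum>k\<in>I. f k) = f i + f j + (\<Sum>k\<in>I' - {i}. f k)" for f :: "'i \<Rightarrow> 'b::comm_monoid_add"
      using Suc.prems(1) i j by (simp add: I'_def sum.remove[of I j] sum.remove[of "I - {j}" i] ac_simps)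
    have rem': "(\<Sum>k\<in>I'. f k) = f i + (\<Sum>k\<in>I' - {i}. f k)" for f :: "'i \<Rightarrow> 'b::comm_monoid_add"
      using I' by (simp add: sum.remove)
    show "(\<Sum>k\<in>I'. 2 ^ e' k) = (2::nat) ^ K"
      using Suc.prems(3) i j unfolding rem rem' by (simp add: e'_def)
    show "P' k x y \<in> {1, -1}" if "k \<in> I'" "x < 2 * n" "y < 2 * n" for k x y
    proof -
      have "k \<in> I" using that I' by auto
      have pm: "P l u v \<in> {1, -1} \<and> - P l u v \<in> {1, -1}" if "l \<in> I" "u < n" "v < n" for l u v
        using Suc.prems(4)[OF that] by auto
      have "block22 (P i) (P j) (P j) (\<lambda>x y. - P i x y) x y \<in> {1, -1}"
        by (rule block22_pm1[of n]) (use pm i(1) j(1) that in blast)+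
      moreover have "block22 (P k) (P k) (\<lambda>x y. - P k x y) (P k) x y \<in> {1, -1}"
        by (rule block22_pm1[of n]) (use pm \<open>k \<in> I\<close> that in blast)+
      ultimately show ?thesis by (simp add: P'_def)
    qed
    show "gram (2 * n) (P' k) (P' l) x y = gram (2 * n) (P' l) (P' k) x y"
      if "k \<in> I'" "l \<in> I'" "x < 2 * n" "y < 2 * n" for k l x y
    proof -
      have "k \<in> I" "l \<in> I" "x div 2 < n" "y div 2 < n" using that I' by auto
      then show ?thesis
        using am[of k l "x div 2" "y div 2"] am[of i l "x div 2" "y div 2"] am[of j l "x div 2" "y div 2"]
          am[of k i "x div 2" "y div 2"] am[of k j "x div 2" "y div 2"] i(1) j(1)
        by (simp add: P'_def gram_block22)
    qed
    show "(\<Sum>k\<in>I'. 2 ^ e' k * gram (2 * n) (P' k) (P' k) x y) =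
        (if x = y then 2 ^ K * real (2 * n) else 0)" if "x < 2 * n" "y < 2 * n" for x y
    proof -
      define x' y' where "x' = x div 2" and "y' = y div 2"
      have xy: "x' < n" "y' < n" using that by (auto simp: x'_def y'_def)
      \<comment> \<open>Up to sign, the mixed parity blocks are
        \<open>P i (P j)^T - P j (P i)^T\<close>, which amicability cancels.\<close>
      have gi: "gram (2 * n) (P' i) (P' i) x y =
        (if even x = even y then gram n (P i) (P i) x' y' + gram n (P j) (P j) x' y' else 0)"
        using am[OF i(1) j(1) xy] by (simp add: P'_def gram_block22 x'_def y'_def)
      have gk: "gram (2 * n) (P' k) (P' k) x y =
        (if even x = even y then 2 * gram n (P k) (P k) x' y' else 0)" if "k \<in> I' - {i}" for k
        using that by (simp add: P'_def gram_block22 x'_def y'_def)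
      have "(\<Sum>k\<in>I'. 2 ^ e' k * gram (2 * n) (P' k) (P' k) x y) =
          2 ^ Suc e0 * gram (2 * n) (P' i) (P' i) x y +
          (\<Sum>k\<in>I' - {i}. 2 ^ e k * gram (2 * n) (P' k) (P' k) x y)"
        unfolding rem' by (simp add: e'_def)
      also have "(\<Sum>k\<in>I' - {i}. 2 ^ e k * gram (2 * n) (P' k) (P' k) x y) =
          (\<Sum>k\<in>I' - {i}. if even x = even y then 2 * (2 ^ e k * gram n (P k) (P k) x' y') else 0)"
        by (intro sum.cong refl) (simp add: gk)
      also have "2 ^ Suc e0 * gram (2 * n) (P' i) (P' i) x y + \<dots> =
          (if even x = even y then 2 * (\<Sum>k\<in>I. 2 ^ e k * gram n (P k) (P k) x' y') else 0)"
        unfolding rem gi using i j by (simp add: sum_distrib_left algebra_simps)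
      also have "\<dots> = (if x = y then 2 ^ K * real (2 * n) else 0)"
        using Suc.prems(6)[OF xy] div2_eq_iff[of x y] by (auto simp: x'_def y'_def)
      finally show ?thesis .
    qed
  qed
  then show ?case by (simp add: mult_ac)
qed


subsection \<open>Hadamard matrices of order \<open>2 ^ t * q\<close>\<close>

text \<open>An injection of the finite residue system into itself is a permutation; periodicity of
  \<open>f\<close> lets \<open>g z\<close> be reduced modulo \<open>m\<close>.\<close>

lemma sum_int_reindex_mod:
  fixes f :: "int \<Rightarrow> real"
  assumes "\<And>x. f (x mod m) = f x"
    and "\<And>x y. \<lbrakk>x \<in> {0..<m}; y \<in> {0..<m}; [g x = g y] (mod m)\<rbrakk> \<Longrightarrow> x = y"
  shows "(\<Sum>z\<in>{0..<m}. f (g z)) = (\<Sum>z\<in>{0..<m}. f z)"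
proof -
  have "bij_betw (\<lambda>z. g z mod m) {0..<m} {0..<m}"
    unfolding bij_betw_def
  proof
    show inj: "inj_on (\<lambda>z. g z mod m) {0..<m}"
      by (intro inj_onI assms(2)) (simp_all add: cong_def)
    show "(\<lambda>z. g z mod m) ` {0..<m} = {0..<m}"
      by (rule endo_inj_surj) (use inj in auto)
  qed
  from sum.reindex_bij_betw[OF this, of f] show ?thesis by (simp add: assms(1))
qed

lemma sum_lessThan_int: "(\<Sum>l<n. f (int l)) = (\<Sum>z\<in>{0..<int n}. f z)"
  by (rule sum.reindex_bij_witness[of _ nat int]) auto

section \<open>The quadratic character modulo an odd prime\<close>

definition quad_char :: "nat \<Rightarrow> int \<Rightarrow> real" where
  "quad_char q z = of_int (Legendre z (int q))"

definition delta_mod :: "nat \<Rightarrow> int \<Rightarrow> real" where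
  "delta_mod q z = of_bool (int q dvd z)"

context
  fixes q :: nat
  assumes prime_q: "prime q" and odd_q: "odd q"
begin

lemma q_gt_2: "q > 2"
  using prime_q odd_q prime_ge_2_nat[of q] by (cases "q = 2") auto

lemma quad_char_mod: "quad_char q (x mod int q) = quad_char q x"
  by (simp add: quad_char_def Legendre_def QuadRes_def cong_def)

lemma delta_mod_mod: "delta_mod q (x mod int q) = delta_mod q x"
  by (simp add: delta_mod_def dvd_mod_iff)

lemma quad_char_eq_0_iff: "quad_char q x = 0 \<longleftrightarrow> int q dvd x"
  by (simp add: quad_char_def Legendre_def cong_0_iff)

lemma quad_char_cases: "quad_char q x \<in> {0, 1, -1}"
  by (simp add: quad_char_def Legendre_def)

lemma quad_char_square: "quad_char q x * quad_char q x = 1 - delta_mod q x"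
  using quad_char_cases[of x] quad_char_eq_0_iff[of x] by (auto simp: delta_mod_def)

text \<open>Euler's criterion makes both sides congruent modulo \<open>q\<close>, and they differ by
  at most 2, which is less than \<open>q\<close>.\<close>

lemma quad_char_mult: "quad_char q (x * y) = quad_char q x * quad_char q y"
proof -
  let ?L = "\<lambda>x. Legendre x (int q)"
  have E: "[?L z = z ^ ((q - 1) div 2)] (mod int q)" for z
    using euler_criterion[OF prime_q q_gt_2] by simp
  have "[?L (x * y) = x ^ ((q - 1) div 2) * y ^ ((q - 1) div 2)] (mod int q)"
    using E[of "x * y"] by (simp only: power_mult_distrib)
  then have "[?L (x * y) = ?L x * ?L y] (mod int q)"
    using cong_mult[OF E[of x] E[of y]] by (metis cong_trans cong_sym)
  then have "int q dvd ?L (x * y) - ?L x * ?L y" by (simp add: cong_iff_dvd_diff)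
  moreover have "\<bar>?L (x * y) - ?L x * ?L y\<bar> < int q"
  proof -
    have "?L z \<in> {0, 1, -1}" for z by (simp add: Legendre_def)
    from this[of x] this[of y] this[of "x * y"] show ?thesis using q_gt_2 by auto
  qed
  ultimately have "?L (x * y) = ?L x * ?L y"
    using zdvd_not_zless[of "\<bar>?L (x * y) - ?L x * ?L y\<bar>" "int q"] by fastforce
  then show ?thesis by (simp add: quad_char_def)
qed

lemma sum_shift_mod:
  fixes f :: "int \<Rightarrow> real"
  assumes "\<And>x. f (x mod int q) = f x"
  shows "(\<Sum>z\<in>{0..<int q}. f (z + a)) = (\<Sum>z\<in>{0..<int q}. f z)"
  using assms by (intro sum_int_reindex_mod) (auto simp: cong_add_rcancel cong_less_imp_eq_int)

lemma sum_scale_mod: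
  fixes f :: "int \<Rightarrow> real"
  assumes "\<And>x. f (x mod int q) = f x" "\<not> int q dvd a"
  shows "(\<Sum>z\<in>{0..<int q}. f (a * z)) = (\<Sum>z\<in>{0..<int q}. f z)"
proof (intro sum_int_reindex_mod assms)
  fix x y assume *: "x \<in> {0..<int q}" "y \<in> {0..<int q}" "[a * x = a * y] (mod int q)"
  have "coprime a (int q)"
    using assms(2) prime_q by (metis coprime_commute prime_imp_coprime prime_nat_int_transfer)
  then have "[x = y] (mod int q)" using * by (simp add: cong_mult_lcancel)
  then show "x = y" using * by (auto intro: cong_less_imp_eq_int)
qed

lemma sum_delta_mod:
  fixes f :: "int \<Rightarrow> real"
  assumes "\<And>x. f (x mod int q) = f x"
  shows "(\<Sum>z\<in>{0..<int q}. delta_mod q (z + a) * f z) = f (- a)"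
proof -
  have fc: "f u = f v" if "u mod int q = v mod int q" for u v
    using assms[of u] assms[of v] that by simp
  have "(\<Sum>z\<in>{0..<int q}. delta_mod q z * f (z - a)) =
      (\<Sum>z\<in>{0..<int q}. delta_mod q (z + a) * f (z + a - a))"
  proof (rule sum_shift_mod [symmetric])
    show "delta_mod q (x mod int q) * f (x mod int q - a) = delta_mod q x * f (x - a)" for x
      using fc[of "x mod int q - a" "x - a"] by (simp add: delta_mod_mod mod_diff_left_eq)
  qed
  moreover have "(\<Sum>z\<in>{0..<int q}. delta_mod q z * f (z - a)) =
      (\<Sum>z\<in>{0..<int q}. if z = 0 then f (- a) else 0)"
    by (intro sum.cong) (auto simp: delta_mod_def dest: zdvd_imp_le)
  ultimately show ?thesis using q_gt_2 by simp
qed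

text \<open>Without nonresidues, squaring would map the nonzero residues onto themselves, hence
  injectively; but 1 and -1 have the same square.\<close>

lemma ex_quad_char_minus_1: "\<exists>g. quad_char q g = -1"
proof (rule ccontr)
  assume neg: "\<not> ?thesis"
  let ?S = "{1..<int q}" and ?sq = "\<lambda>x. x ^ 2 mod int q"
  have pq: "prime (int q)" using prime_q by simp
  have nd: "\<not> int q dvd x" if "x \<in> ?S" for x using that by (auto dest: zdvd_imp_le)
  have sub: "?sq ` ?S \<subseteq> ?S"
  proof safe
    fix x assume "x \<in> ?S"
    then have "\<not> int q dvd x ^ 2" using nd pq prime_dvd_power_int by blast
    then have "?sq x \<noteq> 0" by (simp add: dvd_eq_mod_eq_0)
    moreover have "0 \<le> ?sq x" "?sq x < int q" using q_gt_2 by auto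
    ultimately show "?sq x \<in> ?S" by simp
  qed
  have "?S \<subseteq> ?sq ` ?S"
  proof
    fix a assume a: "a \<in> ?S"
    have "quad_char q a \<noteq> -1" using neg by blast
    then have "Legendre a (int q) \<noteq> -1" by (auto simp: quad_char_def)
    then have "QuadRes (int q) a" by (auto simp: Legendre_def cong_0_iff nd[OF a] split: if_splits)
    then obtain y where y: "[y ^ 2 = a] (mod int q)" by (auto simp: QuadRes_def)
    then have ya: "y ^ 2 mod int q = a" using a by (simp add: cong_def)
    have "?sq (y mod int q) = a" using ya by (simp add: power_mod)
    moreover have "y mod int q \<in> ?S"
    proof -
      have "y mod int q \<noteq> 0" using \<open>?sq (y mod int q) = a\<close> a by auto
      moreover have "0 \<le> y mod int q" "y mod int q < int q" using q_gt_2 by auto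
      ultimately show ?thesis by simp
    qed
    ultimately show "a \<in> ?sq ` ?S" by blast
  qed
  then have inj: "inj_on ?sq ?S" using sub by (intro finite_surj_inj) auto
  have "?sq (int q - 1) = ?sq 1"
  proof -
    have "(int q - 1) ^ 2 = 1 + int q * (int q - 2)" by (simp add: power2_eq_square algebra_simps)
    then show ?thesis by (simp only: mod_mult_self2 power_one)
  qed
  from inj_onD[OF inj this] have "int q - 1 = 1" using q_gt_2 by simp
  then show False using q_gt_2 by simp
qed

text \<open>Multiplication by a nonresidue permutes the residues and negates the sum.\<close>

lemma sum_quad_char: "(\<Sum>z\<in>{0..<int q}. quad_char q z) = 0"
proof -
  obtain g where g: "quad_char q g = -1" using ex_quad_char_minus_1 by auto
  then have "\<not> int q dvd g" using quad_char_eq_0_iff[of g] by auto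
  from sum_scale_mod[of "quad_char q", OF quad_char_mod this] show ?thesis
    by (simp add: quad_char_mult g sum_negf)
qed

text \<open>The autocorrelation at shift \<open>d\<close> is the same for all nonzero \<open>d\<close> (substitute \<open>d * z\<close> for
  \<open>z\<close>), and summed over all \<open>d\<close> the autocorrelations cancel.\<close>
lemma sum_quad_char_shift:
  "(\<Sum>z\<in>{0..<int q}. quad_char q z * quad_char q (z + d)) = real q * delta_mod q d - 1"
proof -
  define T where "T = (\<lambda>d. \<Sum>z\<in>{0..<int q}. quad_char q z * quad_char q (z + d))"
  have mod_add: "quad_char q (x mod int q + d) = quad_char q (x + d)" for x d
    by (metis mod_add_left_eq quad_char_mod)
  have T0: "T d = real q - 1" if "int q dvd d" for d
  proof -
    have "quad_char q (z + d) = quad_char q z" for z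
      using that by (metis dvd_eq_mod_eq_0 mod_add_right_eq add.right_neutral quad_char_mod)
    then have "T d = (\<Sum>z\<in>{0..<int q}. 1 - delta_mod q z)"
      by (simp add: T_def quad_char_square)
    also have "\<dots> = real q - 1"
      using sum_delta_mod[of "\<lambda>_. 1" 0] by (simp add: sum_subtractf)
    finally show ?thesis .
  qed
  have T1: "T d = T 1" if "\<not> int q dvd d" for d
  proof -
    have "(\<Sum>z\<in>{0..<int q}. quad_char q (d * z) * quad_char q (d * z + d)) = T d"
      unfolding T_def using that
      by (intro sum_scale_mod[of "\<lambda>z. quad_char q z * quad_char q (z + d)"]) (simp_all add: quad_char_mod mod_add)
    moreover have "quad_char q (d * z) * quad_char q (d * z + d) = quad_char q z * quad_char q (z + 1)" for z
    proof -
      have "d * z + d = d * (z + 1)" by (simp add: algebra_simps)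
      then have "quad_char q (d * z) * quad_char q (d * z + d) =
          (quad_char q d * quad_char q d) * (quad_char q z * quad_char q (z + 1))"
        by (simp only: quad_char_mult mult_ac)
      then show ?thesis using that by (simp add: quad_char_square delta_mod_def)
    qed
    ultimately show ?thesis by (simp add: T_def)
  qed
  have "(\<Sum>d\<in>{0..<int q}. T d) = (\<Sum>z\<in>{0..<int q}. quad_char q z * (\<Sum>d\<in>{0..<int q}. quad_char q (d + z)))"
    unfolding T_def by (subst sum.swap) (simp add: sum_distrib_left add.commute)
  also have "\<dots> = 0"
    using sum_shift_mod[of "quad_char q", OF quad_char_mod] by (simp add: sum_quad_char)
  also have "(\<Sum>d\<in>{0..<int q}. T d) = T 0 + (\<Sum>d\<in>{0..<int q} - {0}. T d)"
    using q_gt_2 by (subst sum.remove[of _ 0]) auto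
  also have "(\<Sum>d\<in>{0..<int q} - {0}. T d) = (\<Sum>d\<in>{0..<int q} - {0}. T 1)"
    by (intro sum.cong refl T1) (auto dest: zdvd_imp_le)
  also have "T 0 + \<dots> = (real q - 1) * (1 + T 1)"
    using q_gt_2 T0[of 0] by (simp add: algebra_simps of_nat_diff nat_diff_distrib)
  finally have "T 1 = -1" using q_gt_2 by simp
  then show ?thesis using T0[of d] T1[of d] by (cases "int q dvd d") (auto simp: T_def delta_mod_def)
qed

text \<open>Using \<open>x + y\<close> instead of \<open>x - y\<close> makes the matrix symmetric
  for every odd prime; the delta term puts 1 where the character vanishes.\<close>

definition paley :: "real \<Rightarrow> nat \<Rightarrow> nat \<Rightarrow> real" where
  "paley \<alpha> x y = delta_mod q (int x + int y) + \<alpha> * quad_char q (int x + int y)"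

lemma paley_commute: "paley \<alpha> x y = paley \<alpha> y x"
  by (simp add: paley_def add.commute)

lemma paley_pm1: "\<alpha> \<in> {1, -1} \<Longrightarrow> paley \<alpha> x y \<in> {1, -1}"
  using quad_char_cases[of "int x + int y"] quad_char_eq_0_iff[of "int x + int y"]
  by (auto simp: paley_def delta_mod_def)

text \<open>Each row meets the delta term once, and the character sums to zero.\<close>

lemma sum_paley: "(\<Sum>l<q. paley \<alpha> x l) = 1"
proof -
  have "(\<Sum>l<q. paley \<alpha> x l) =
      (\<Sum>z\<in>{0..<int q}. delta_mod q (z + int x) * 1 + \<alpha> * quad_char q (z + int x))"
    unfolding paley_def by (subst sum_lessThan_int [symmetric]) (simp add: add.commute)
  also have "\<dots> = (\<Sum>z\<in>{0..<int q}. delta_mod q (z + int x) * 1) +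
      \<alpha> * (\<Sum>z\<in>{0..<int q}. quad_char q (z + int x))"
    by (simp only: sum.distrib sum_distrib_left)
  also have "\<dots> = 1"
    using sum_delta_mod[of "\<lambda>_. 1"] sum_shift_mod[of "quad_char q", OF quad_char_mod]
    by (simp add: sum_quad_char)
  finally show ?thesis .
qed

text \<open>Expanding the product, each delta selects one value and the two characters give the
  autocorrelation. The factor \<open>quad_char q (-1)\<close> comes from turning
  \<open>x - y\<close> into \<open>y - x\<close>.\<close>

lemma gram_paley:
  "gram q (paley \<alpha>) (paley \<beta>) x y =
    delta_mod q (int y - int x) + (\<beta> + \<alpha> * quad_char q (-1)) * quad_char q (int y - int x) +
    \<alpha> * \<beta> * (real q * delta_mod q (int y - int x) - 1)"
proof -
  let ?d = "delta_mod q" and ?c = "quad_char q" and ?Z = "{0..<int q}"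
  have modd: "?d (z mod int q + w) = ?d (z + w)" "?c (z mod int q + w) = ?c (z + w)" for z w
    by (metis mod_add_left_eq delta_mod_mod) (metis mod_add_left_eq quad_char_mod)
  have "gram q (paley \<alpha>) (paley \<beta>) x y = (\<Sum>z\<in>?Z. (?d (z + x) + \<alpha> * ?c (z + x)) * (?d (z + y) + \<beta> * ?c (z + y)))"
    unfolding gram_def paley_def by (subst sum_lessThan_int [symmetric]) (simp add: add.commute)
  also have "\<dots> = (\<Sum>z\<in>?Z. ?d (z + x) * (?d (z + y) + \<beta> * ?c (z + y))) + \<alpha> * (\<Sum>z\<in>?Z. ?d (z + y) * ?c (z + x)) +
      \<alpha> * \<beta> * (\<Sum>z\<in>?Z. ?c (z + x) * ?c (z + y))"
    by (simp add: sum.distrib sum_distrib_left algebra_simps)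
  also have "(\<Sum>z\<in>?Z. ?d (z + x) * (?d (z + y) + \<beta> * ?c (z + y))) = ?d (- int x + y) + \<beta> * ?c (- int x + y)"
    by (rule sum_delta_mod) (simp add: modd)
  also have "(\<Sum>z\<in>?Z. ?d (z + y) * ?c (z + x)) = ?c (- int y + x)"
    by (rule sum_delta_mod) (simp add: modd)
  also have "\<dots> = ?c (-1) * ?c (int y - int x)"
    by (simp add: quad_char_mult [symmetric])
  also have "(\<Sum>z\<in>?Z. ?c (z + x) * ?c (z + y)) = (\<Sum>z\<in>?Z. ?c z * ?c (z + (int y - int x)))"
    using sum_shift_mod[of "\<lambda>z. ?c z * ?c (z + (int y - int x))" x] by (simp add: modd quad_char_mod)
  also have "\<dots> = real q * ?d (int y - int x) - 1" by (rule sum_quad_char_shift)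
  finally show ?thesis by (simp add: algebra_simps)
qed

lemma delta_mod_diff:
  assumes "x < q" "y < q"
  shows "delta_mod q (int y - int x) = of_bool (x = y)"
proof -
  have "int q dvd int y - int x \<longleftrightarrow> int y mod int q = int x mod int q" by (simp add: mod_eq_dvd_iff)
  also have "\<dots> \<longleftrightarrow> x = y" using assms by auto
  finally show ?thesis by (simp add: delta_mod_def)
qed

text \<open>The family consists of \<open>b\<close> copies of \<open>J - 2I\<close>, \<open>2s - b\<close> copies of \<open>J\<close> and equally many copies of the
  two Paley type matrices; their Gram matrices have the constant off-diagonal entries \<open>q - 4\<close>, \<open>q\<close> and
  (for the sum of the two Paley types) \<open>-2\<close>. The sum vanishes because \<open>s * (q + 1) div 2 = 2 ^ f + b\<close>.\<close>
lemma ex_hadamard_matrix_odd_prime: "\<exists>t>0. \<exists>H. hadamard_matrix (2 ^ t * q) H"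
proof -
  define m where "m = (q + 1) div 2"
  have qm: "q + 1 = 2 * m" using odd_q by (simp add: m_def)
  then have m: "m \<ge> 2" using q_gt_2 by simp
  \<comment> \<open>Squaring \<open>m < 2 ^ m\<close> gives \<open>m * m < 2 ^ f\<close>, which
    forces \<open>m < s\<close> below.\<close>
  define f where "f = 2 * m"
  have f: "m * m < 2 ^ f"
  proof -
    have "m < 2 ^ m" by simp
    then have "m * m < 2 ^ m * 2 ^ m" by (intro mult_strict_mono) auto
    then show ?thesis by (simp add: f_def mult_2 power_add)
  qed
  \<comment> \<open>\<open>s * m\<close> is the first multiple of \<open>m\<close> above
    \<open>2 ^ f\<close>, so the excess \<open>b\<close> is at most \<open>m\<close>.\<close>
  define s where "s = 2 ^ f div m + 1"
  have sm: "s * m > 2 ^ f" "s * m \<le> 2 ^ f + m"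
    using m mod_less_divisor[of m "2 ^ f"] div_mult_mod_eq[of "2 ^ f" m] unfolding s_def distrib_right mult_1 by linarith+
  define b where "b = s * m - 2 ^ f"
  have b: "s * m = 2 ^ f + b" "b \<le> m" using sm by (auto simp: b_def)
  \<comment> \<open>With \<open>s \<le> 2 ^ f\<close>, this keeps the multiplicities
    \<open>b\<close>, \<open>2 * s - b\<close> and \<open>2 * 2 ^ f - s\<close> nonnegative.\<close>
  have ms: "m < s" using f sm(1) by (metis less_trans mult_less_cancel2)
  have s2: "s \<le> 2 ^ f"
  proof -
    have "2 * s \<le> s * m" using m by simp
    also have "\<dots> \<le> 2 ^ f + s" using sm ms by simp
    finally show ?thesis by simp
  qed
  define J D :: "nat \<Rightarrow> nat \<Rightarrow> real" where "J = (\<lambda>_ _. 1)" and "D = (\<lambda>x y. if x = y then -1 else 1)"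
  \<comment> \<open>For the parameters 1 and \<open>- \<epsilon>\<close>, the character coefficients
    are \<open>- \<epsilon> + \<epsilon>\<close> and \<open>1 - \<epsilon> * \<epsilon>\<close> in
    the two mixed products, both zero. In the two self products they are
    \<open>1 + \<epsilon>\<close> and \<open>- \<epsilon> - 1\<close>, which cancel in the
    sum.\<close>
  define \<epsilon> where "\<epsilon> = quad_char q (-1)"
  have eps: "\<epsilon> \<in> {1, -1}"
    using quad_char_cases[of "-1"] quad_char_eq_0_iff[of "-1"] q_gt_2 by (auto simp: \<epsilon>_def)
  have D_eq: "D x y = 1 - 2 * (if y = x then 1 else 0)" for x y by (simp add: D_def)
  have JX: "gram q J A x y = (\<Sum>l<q. A y l)" for A x y
    by (simp add: gram_def J_def)
  have DX: "gram q D A x y = (\<Sum>l<q. A y l) - 2 * A y x" if "x < q" for A x y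
  proof -
    have "gram q D A x y = (\<Sum>l<q. A y l - (if l = x then 2 * A y x else 0))"
      unfolding gram_def by (intro sum.cong) (auto simp: D_def)
    then show ?thesis using that by (simp add: sum_subtractf)
  qed
  have rowD: "(\<Sum>l<q. D x l) = real q - 2" if "x < q" for x
    using that by (simp add: D_eq sum_subtractf sum.delta sum_distrib_left [symmetric])
  have rowJ: "(\<Sum>l<q. J x l) = real q" for x by (simp add: J_def)
  have amic: "gram q A B x y = gram q B A x y"
    if "A \<in> {J, D, paley 1, paley (- \<epsilon>)}" "B \<in> {J, D, paley 1, paley (- \<epsilon>)}" "x < q" "y < q" for A B x y
  proof -
    have JP: "gram q J (paley \<alpha>) x y = gram q (paley \<alpha>) J x y" for \<alpha>
      using gram_commute[of q "paley \<alpha>" J x y] by (simp add: JX sum_paley)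
    \<comment> \<open>One order yields the row sum minus twice the entry at \<open>(y, x)\<close>,
      the other the same with \<open>(x, y)\<close>; the symmetry of the Paley type matrix
      identifies them.\<close>
    have DP: "gram q D (paley \<alpha>) x y = gram q (paley \<alpha>) D x y" for \<alpha>
      using gram_commute[of q "paley \<alpha>" D x y] that(3,4) paley_commute[of \<alpha> x y] by (simp add: DX sum_paley)
    have JD: "gram q J D x y = gram q D J x y"
      using that(3,4) by (simp add: DX JX rowD rowJ) (simp add: J_def)
    have PP: "gram q (paley 1) (paley (- \<epsilon>)) x y = gram q (paley (- \<epsilon>)) (paley 1) x y"
      using eps by (auto simp: gram_paley \<epsilon>_def [symmetric])
    show ?thesis using that(1,2) by (elim insertE emptyE) (simp_all only: JP DP JD PP)
  qed
  define P where "P = (\<lambda>i. if i < b then D else if i < 2 * s then J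
    else if i < s + 2 * 2 ^ f then paley 1 else paley (- \<epsilon>))"
  have P_mem: "P i \<in> {J, D, paley 1, paley (- \<epsilon>)}" for i by (simp add: P_def)
  \<comment> \<open>Each merge removes one matrix, so \<open>4 * 2 ^ f\<close> matrices need one
    merge fewer. All initial weights are 1, with total \<open>2 ^ (f + 2)\<close>.\<close>
  define m' where "m' = 4 * 2 ^ f - (1::nat)"
  have "\<exists>H. hadamard_matrix (2 ^ m' * q) H"
  proof (rule hadamard_matrix_of_amicable[of "{..<4 * 2 ^ f}" m' "\<lambda>_. 0" "f + 2" q P])
    show "card {..<4 * 2 ^ f :: nat} = Suc m'" by (simp add: m'_def)
    show "(\<Sum>i<4 * 2 ^ f :: nat. 2 ^ 0) = (2::nat) ^ (f + 2)" by (simp add: power_add)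
    show "P i x y \<in> {1, -1}" for i x y
    proof -
      have "\<forall>A\<in>{J, D, paley 1, paley (- \<epsilon>)}. A x y \<in> {1, -1}"
        using paley_pm1[of 1 x y] paley_pm1[of "- \<epsilon>" x y] eps by (auto simp: J_def D_def)
      then show ?thesis using P_mem by blast
    qed
    show "gram q (P i) (P j) x y = gram q (P j) (P i) x y" if "x < q" "y < q" for i j x y
      using amic[OF P_mem P_mem that] .
    show "(\<Sum>i<4 * 2 ^ f. 2 ^ 0 * gram q (P i) (P i) x y) = (if x = y then 2 ^ (f + 2) * real q else 0)"
      if xy: "x < q" "y < q" for x y
    proof -
      define G where "G = (\<lambda>A. gram q A A x y)"
      have bs: "b \<le> 2 * s" using b ms by simp
      have "(\<Sum>i<4 * 2 ^ f. 2 ^ 0 * gram q (P i) (P i) x y) = (\<Sum>i\<in>{0..<4 * 2 ^ f}. G (P i))"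
        by (simp add: G_def atLeast0LessThan)
      also have "\<dots> = (\<Sum>i\<in>{0..<b}. G (P i)) + (\<Sum>i\<in>{b..<2 * s}. G (P i)) +
          (\<Sum>i\<in>{2 * s..<s + 2 * 2 ^ f}. G (P i)) + (\<Sum>i\<in>{s + 2 * 2 ^ f..<4 * 2 ^ f}. G (P i))"
        using bs s2 by (simp add: sum.atLeastLessThan_concat)
      also have "\<dots> = (\<Sum>i\<in>{0..<b}. G D) + (\<Sum>i\<in>{b..<2 * s}. G J) +
          (\<Sum>i\<in>{2 * s..<s + 2 * 2 ^ f}. G (paley 1)) + (\<Sum>i\<in>{s + 2 * 2 ^ f..<4 * 2 ^ f}. G (paley (- \<epsilon>)))"
        using bs s2 by (intro arg_cong2[of _ _ _ _ "(+)"] sum.cong refl) (auto simp: P_def)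
      also have "\<dots> = b * G D + (2 * real s - b) * G J + (2 * 2 ^ f - real s) * (G (paley 1) + G (paley (- \<epsilon>)))"
        using bs s2 by (simp add: of_nat_diff algebra_simps)
      also have "G J = q" by (simp add: G_def JX rowJ)
      also have "G D = real q - 4 + 4 * of_bool (x = y)"
        using xy by (simp add: G_def DX rowD) (simp add: D_def)
      also have "G (paley 1) + G (paley (- \<epsilon>)) = 2 * (real q + 1) * of_bool (x = y) - 2"
        using eps by (auto simp: G_def gram_paley \<epsilon>_def [symmetric] delta_mod_diff[OF xy] algebra_simps)
      also have "b * (real q - 4 + 4 * of_bool (x = y)) + (2 * real s - b) * real q +
          (2 * 2 ^ f - real s) * (2 * (real q + 1) * of_bool (x = y) - 2) =
          (if x = y then 2 ^ (f + 2) * real q else 0)"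
      proof -
        have q': "real q = 2 * real m - 1" using qm by linarith
        have b': "real b = real s * real m - 2 ^ f" using b(1) by (metis add_diff_cancel_left' of_nat_add of_nat_mult of_nat_numeral of_nat_power)
        show ?thesis by (simp add: q' b' power_add algebra_simps)
      qed
      finally show ?thesis .
    qed
  qed simp
  moreover have "m' > 0" using one_le_power[of "2::nat" f] unfolding m'_def by linarith
  ultimately show ?thesis by blast
qed

end


subsection \<open>The field with \<open>2 ^ t\<close> elements\<close>

lemma two_eq_0_alg_closure_bit: "(2 :: bit alg_closure) = 0"
proof -
  have "(2 :: bit alg_closure) = to_ac (1 + 1)"
    by (subst to_ac_add) simp
  also have "\<dots> = 0" by (simp del: to_ac_add)
  finally show ?thesis .
qed

text \<open>The Frobenius map is additive in characteristic two; hence its fixed points are closed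
  under subtraction.\<close>

lemma diff_power_2_power_alg_closure_bit:
  "(x - y :: bit alg_closure) ^ (2 ^ t) = x ^ (2 ^ t) - y ^ (2 ^ t)"
proof (induction t)
  case (Suc t)
  have *: "(a - b) ^ 2 = a ^ 2 - b ^ 2" for a b :: "bit alg_closure"
  proof -
    have "(a - b) ^ 2 = a ^ 2 - b ^ 2 - 2 * (a * b - b ^ 2)"
      by (simp add: power2_eq_square algebra_simps)
    then show ?thesis by (simp add: two_eq_0_alg_closure_bit)
  qed
  have "(x - y) ^ (2 ^ Suc t) = ((x - y) ^ (2 ^ t)) ^ 2"
    by (simp add: power_mult [symmetric] mult.commute)
  also have "\<dots> = x ^ (2 ^ Suc t) - y ^ (2 ^ Suc t)"
    by (simp add: Suc * power_mult [symmetric] mult.commute)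
  finally show ?case .
qed auto

text \<open>The fixed points are the roots of \<open>x ^ (2 ^ t) - x\<close>. Its derivative is the
  constant -1, so no root is repeated and there are as many roots as the degree.\<close>

lemma card_fixed_points_Frobenius_bit:
  assumes "t > 0"
  shows "card {x :: bit alg_closure. x ^ (2 ^ t) = x} = 2 ^ t"
proof -
  define p :: "bit alg_closure poly" where "p = monom 1 (2 ^ t) + monom (-1) 1"
  have t2: "(2::nat) ^ t > 1" using assms one_less_power[of "2::nat" t] by simp
  have deg: "degree p = 2 ^ t"
    unfolding p_def using t2 by (subst degree_add_eq_left) (auto simp: degree_monom_eq)
  have lc: "lead_coeff p = 1"
    using t2 unfolding deg by (simp add: p_def)
  obtain A where A: "size A = degree p" "p = smult (lead_coeff p) (\<Prod>x\<in>#A. [:-x, 1:])"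
    using alg_closed_imp_factorization[of p] deg t2 by fastforce
  have pA: "p = (\<Prod>x\<in>#A. [:-x, 1:])" using A(2) lc by simp
  have pz: "poly p x = x ^ (2 ^ t) - x" for x by (simp add: p_def poly_monom)
  have der: "pderiv p = -1"
    unfolding p_def using assms by (simp add: pderiv_add pderiv_monom two_eq_0_alg_closure_bit monom_0 zero_power one_pCons)
  have root: "poly p x = 0 \<longleftrightarrow> x \<in># A" for x
    by (auto simp: pA poly_prod_mset prod_mset_zero_iff)
  have "count A x \<le> 1" for x
  proof (rule ccontr)
    assume "\<not> count A x \<le> 1"
    then have "{#x, x#} \<subseteq># A" by (simp add: subseteq_mset_def)
    then obtain B where B: "A = {#x, x#} + B" using mset_subset_eq_exists_conv by blast
    define r where "r = (\<Prod>x\<in>#B. [:-x, 1:])"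
    have "p = [:-x, 1:] * ([:-x, 1:] * r)"
      unfolding pA B r_def by (simp add: mult_ac del: mult_pCons_left mult_pCons_right)
    then have "poly (pderiv p) x = 0"
      by (simp add: pderiv_mult del: mult_pCons_left mult_pCons_right)
    then show False by (simp add: der)
  qed
  then have "card (set_mset A) = size A"
    by (metis (no_types, lifting) One_nat_def card_eq_sum le_antisym One_nat_def Suc_leI count_greater_zero_iff size_multiset_overloaded_eq sum.cong)
  moreover have "set_mset A = {x. x ^ (2 ^ t) = x}"
    using root pz by auto
  ultimately show ?thesis using A(1) deg by simp
qed

text \<open>Over the field with \<open>2 ^ t\<close> elements, take \<open>L a x y = x + a * y\<close>.\<close>
lemma ex_latin_family:
  assumes "t > 0" and n: "n = (2::nat) ^ t"
  obtains L :: "nat \<Rightarrow> nat \<Rightarrow> nat \<Rightarrow> nat" where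
    "\<And>a x y. \<lbrakk>a < n; x < n; y < n\<rbrakk> \<Longrightarrow> L a x y < n"
    and "\<And>a x x' y. \<lbrakk>a < n; x < n; x' < n; y < n; L a x y = L a x' y\<rbrakk> \<Longrightarrow> x = x'"
    and "\<And>a b x x'. \<lbrakk>a < n; b < n; a \<noteq> b; x < n; x' < n\<rbrakk> \<Longrightarrow>
      \<exists>y<n. \<forall>y'<n. L a x y' = L b x' y' \<longleftrightarrow> y' = y"
proof -
  define F where "F = {x :: bit alg_closure. x ^ (2 ^ t) = x}"
  have card: "card F = n" using card_fixed_points_Frobenius_bit[OF assms(1)] by (simp add: F_def n)
  have "n > 0" by (simp add: n)
  then have "finite F" using card card.infinite by fastforce
  have diff: "x - y \<in> F" if "x \<in> F" "y \<in> F" for x y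
    using that by (simp add: F_def diff_power_2_power_alg_closure_bit)
  have mult: "x * y \<in> F" if "x \<in> F" "y \<in> F" for x y
    using that by (simp add: F_def power_mult_distrib)
  have div: "x / y \<in> F" if "x \<in> F" "y \<in> F" for x y
    using that by (simp add: F_def power_divide)
  have add: "x + y \<in> F" if "x \<in> F" "y \<in> F" for x y
  proof -
    have "0 \<in> F" by (simp add: F_def)
    then show ?thesis using diff[OF that(1) diff[OF _ that(2)], of 0] by simp
  qed
  \<comment> \<open>\<open>g\<close> numbers the field elements and \<open>h\<close> decodes the
    numbers, so that natural indices stand for elements of \<open>F\<close>.\<close>
  obtain g where g: "bij_betw g F {..<n}"
    using ex_bij_betw_finite_nat[OF \<open>finite F\<close>] card by (auto simp: atLeast0LessThan)
  define h where "h = inv_into F g"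
  have h: "bij_betw h {..<n} F" unfolding h_def using g by (rule bij_betw_inv_into)
  have hF: "h i \<in> F" if "i < n" for i using h that by (auto simp: bij_betw_def)
  have h_inj: "h i = h j \<longleftrightarrow> i = j" if "i < n" "j < n" for i j
    using h that by (auto simp: bij_betw_def inj_on_def)
  have g_inj: "g x = g y \<longleftrightarrow> x = y" if "x \<in> F" "y \<in> F" for x y
    using g that by (auto simp: bij_betw_def inj_on_def)
  have gn: "g x < n" if "x \<in> F" for x using g that by (auto simp: bij_betw_def)
  define L where "L = (\<lambda>a x y. g (h x + h a * h y))"
  have L_eq: "L a x y = L b x' y' \<longleftrightarrow> h x + h a * h y = h x' + h b * h y'"
    if "a < n" "b < n" "x < n" "x' < n" "y < n" "y' < n" for a b x x' y y'
    unfolding L_def using that by (intro g_inj add mult hF)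
  show ?thesis
  proof (rule that[of L])
    show "\<exists>y<n. \<forall>y'<n. L a x y' = L b x' y' \<longleftrightarrow> y' = y"
      if *: "a < n" "b < n" "a \<noteq> b" "x < n" "x' < n" for a b x x'
    proof -
    have ne: "h a - h b \<noteq> 0" using * h_inj by auto
    \<comment> \<open>This is the solution for \<open>h y\<close> of the linear equation
      \<open>h x + h a * h y = h x' + h b * h y\<close>.\<close>
    have "(h x' - h x) / (h a - h b) \<in> F" using * by (intro div diff hF)
    then obtain y where y: "y < n" "h y = (h x' - h x) / (h a - h b)"
      using h by (auto simp: bij_betw_def)
    have "L a x y' = L b x' y' \<longleftrightarrow> y' = y" if "y' < n" for y'
    proof -
      have "L a x y' = L b x' y' \<longleftrightarrow> h y' * (h a - h b) = h x' - h x"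
        using * that by (subst L_eq) (auto simp: algebra_simps)
      also have "\<dots> \<longleftrightarrow> h y' = h y" using ne by (simp add: y(2) nonzero_eq_divide_eq)
      finally show ?thesis using h_inj that y(1) by simp
    qed
    then show "\<exists>y<n. \<forall>y'<n. L a x y' = L b x' y' \<longleftrightarrow> y' = y" using y(1) by blast
    qed
  qed (auto simp: L_eq h_inj, auto simp: L_def intro!: gn add mult hF)
qed


subsection \<open>Quasi-unbiased families from a Hadamard matrix of order \<open>2 ^ t * q\<close>\<close>

lemma hadamard_matrix_imp_weighing_matrix: "hadamard_matrix n H \<Longrightarrow> weighing_matrix n n H"
  by (auto simp: hadamard_matrix_def weighing_matrix_def)

text \<open>For square matrices a right inverse is also a left inverse, so orthogonality of rows
  passes to columns.\<close>

lemma hadamard_matrix_columns: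
  assumes H: "hadamard_matrix n H" and ij: "i < n" "j < n"
  shows "(\<Sum>l<n. H l i * H l j) = (if i = j then real n else 0)"
proof -
  define A B where "A = mat n n (\<lambda>(i, j). H i j)" and "B = mat n n (\<lambda>(i, j). H j i / real n)"
  have "A * B = 1\<^sub>m n"
  proof (rule eq_matI)
    fix k l assume kl: "k < dim_row (1\<^sub>m n :: real mat)" "l < dim_col (1\<^sub>m n :: real mat)"
    have "(A * B) $$ (k, l) = gram n H H k l / real n"
      using kl by (simp add: A_def B_def scalar_prod_def gram_def sum_divide_distrib atLeast0LessThan)
    then show "(A * B) $$ (k, l) = 1\<^sub>m n $$ (k, l)"
      using H kl by (simp add: hadamard_matrix_iff)
  qed (simp_all add: A_def B_def)
  then have "B * A = 1\<^sub>m n"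
    by (intro mat_mult_left_right_inverse[of A n B]) (simp_all add: A_def B_def)
  then have "(B * A) $$ (i, j) = (if i = j then 1 else 0)" using ij by simp
  moreover have "(B * A) $$ (i, j) = (\<Sum>l<n. H l i * H l j) / real n"
    using ij by (simp add: A_def B_def scalar_prod_def sum_divide_distrib atLeast0LessThan)
  ultimately show ?thesis using ij by (auto simp: field_simps split: if_splits)
qed

text \<open>With \<open>M = H1 H2^T\<close>, column orthogonality of \<open>H2\<close> gives
  \<open>M M^T = n H1 H1^T = n^2 I\<close>; dividing by \<open>d^2\<close> leaves weight
  \<open>k\<close>.\<close>

lemma quasi_unbiasedI:
  assumes H1: "hadamard_matrix n H1" and H2: "hadamard_matrix n H2"
    and d: "d > 0" "d ^ 2 * k = n ^ 2"
    and ent: "\<And>i j. i < n \<Longrightarrow> j < n \<Longrightarrow> gram n H1 H2 i j \<in> {0, real d, - real d}"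
  shows "quasi_unbiased n n k (d ^ 2) H1 H2"
proof -
  define W where "W = mat_scale (1 / sqrt (real (d ^ 2))) (mat_mult n H1 (mat_transpose H2))"
  have W: "W i j = gram n H1 H2 i j / real d" for i j
    by (simp add: W_def mat_scale_def mat_mult_def mat_transpose_def gram_def)
  have "W i j \<in> {0, 1, -1}" if "i < n" "j < n" for i j
    using ent[OF that] d(1) by (auto simp: W)
  moreover have "mat_mult n W (mat_transpose W) i j = (if i = j then real k else 0)"
    if ij: "i < n" "j < n" for i j
  proof -
    have "(\<Sum>l<n. gram n H1 H2 i l * gram n H1 H2 j l) =
        (\<Sum>l<n. \<Sum>u<n. \<Sum>v<n. H1 i u * H1 j v * (H2 l u * H2 l v))"
      by (simp add: gram_def sum_product mult_ac)
    also have "\<dots> = (\<Sum>u<n. \<Sum>v<n. \<Sum>l<n. H1 i u * H1 j v * (H2 l u * H2 l v))"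
      by (subst sum.swap) (intro sum.cong refl sum.swap)
    also have "\<dots> = (\<Sum>u<n. \<Sum>v<n. H1 i u * H1 j v * (if u = v then real n else 0))"
      by (intro sum.cong refl) (simp add: sum_distrib_left [symmetric] hadamard_matrix_columns[OF H2])
    also have "\<dots> = (\<Sum>u<n. H1 i u * H1 j u * real n)"
      by (intro sum.cong refl) (simp add: if_distrib sum.delta cong: if_cong)
    also have "\<dots> = gram n H1 H1 i j * real n"
      by (simp add: gram_def sum_distrib_right)
    also have "\<dots> = (if i = j then real (n ^ 2) else 0)"
      using H1 ij by (simp add: hadamard_matrix_iff power2_eq_square)
    also have "real (n ^ 2) = real d ^ 2 * real k"
      using d(2) by (metis of_nat_mult of_nat_power)
    finally show ?thesis using d(1)
      by (simp add: mat_mult_def mat_transpose_def W power2_eq_square flip: sum_divide_distrib)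
  qed
  ultimately show ?thesis
    using H1 H2 unfolding quasi_unbiased_def W_def [symmetric]
    by (simp add: hadamard_matrix_imp_weighing_matrix weighing_matrix_def[of n k])
qed

section \<open>Block matrices over a Latin family\<close>

lemma sum_div_mod:
  fixes f :: "nat \<Rightarrow> nat \<Rightarrow> real"
  shows "(\<Sum>j<n * m. f (j div m) (j mod m)) = (\<Sum>y<n. \<Sum>w<m. f y w)"
proof -
  have "(\<Sum>j<n * m. f (j div m) (j mod m)) = (\<Sum>y<n. \<Sum>j\<in>{y * m..<y * m + m}. f (j div m) (j mod m))"
    by (rule sum.nat_group [symmetric])
  also have "\<dots> = (\<Sum>y<n. \<Sum>w<m. f y w)"
  proof (rule sum.cong [OF refl])
    fix y
    show "(\<Sum>j\<in>{y * m..<y * m + m}. f (j div m) (j mod m)) = (\<Sum>w<m. f y w)"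
      using sum.shift_bounds_nat_ivl[of "\<lambda>j. f (j div m) (j mod m)" 0 "y * m" m]
      by (simp add: atLeast0LessThan add.commute)
  qed
  finally show ?thesis .
qed

lemma mult_add_eq_iff:
  fixes q :: nat
  assumes "v < q" "v' < q"
  shows "k * q + v = k' * q + v' \<longleftrightarrow> k = k' \<and> v = v'"
proof
  assume eq: "k * q + v = k' * q + v'"
  have "k = (k * q + v) div q" "k' = (k' * q + v') div q" using assms by auto
  then show "k = k' \<and> v = v'" using eq by auto
qed auto

text \<open>The block matrix indexed by \<open>x, y < n\<close> whose \<open>(x, y)\<close> block is \<open>c \<otimes> S\<^sub>k\<close>, where \<open>c\<close> is the
  \<open>y\<close>-th column of \<open>K\<close>, \<open>k = l x y\<close>, and \<open>S\<^sub>k\<close> consists of the rows \<open>k * q, ..., k * q + q - 1\<close> of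
  \<open>S\<close>. The row index is \<open>(u * n + x) * q + v\<close> with \<open>u\<close> the row of \<open>c\<close> and \<open>v\<close> the row of \<open>S\<^sub>k\<close>.\<close>
definition latin_blocks :: "nat \<Rightarrow> nat \<Rightarrow> (nat \<Rightarrow> nat \<Rightarrow> real) \<Rightarrow> (nat \<Rightarrow> nat \<Rightarrow> real) \<Rightarrow>
    (nat \<Rightarrow> nat \<Rightarrow> nat) \<Rightarrow> nat \<Rightarrow> nat \<Rightarrow> real" where
  "latin_blocks n q K S l i j =
     K (i div q div n) (j div (n * q)) * S (l (i div q mod n) (j div (n * q)) * q + i mod q) (j mod (n * q))"

context
  fixes n q :: nat and K S :: "nat \<Rightarrow> nat \<Rightarrow> real"
  assumes q: "q > 0" and K: "hadamard_matrix n K" and S: "hadamard_matrix (n * q) S"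
begin

lemma index_bounds:
  assumes "i < n * (n * q)"
  shows "i div q div n < n" "i div q mod n < n" "i mod q < q"
proof -
  have "i < n * n * q" using assms by (simp add: mult.assoc)
  then have "i div q < n * n" by (simp add: less_mult_imp_div_less)
  then show "i div q div n < n" by (simp add: less_mult_imp_div_less)
  have "n > 0" using assms by (cases n) auto
  then show "i div q mod n < n" by simp
qed (use q in simp)

lemma chunk_bound: "k < n \<Longrightarrow> v < q \<Longrightarrow> k * q + v < n * q"
  using mult_le_mono1[of "Suc k" n q] by simp

text \<open>The rows of \<open>S\<close> are orthogonal, so a block column \<open>y\<close>
  contributes only when both sides use the same chunk of \<open>S\<close> and the same row in
  it.\<close>

lemma gram_latin_blocks:
  assumes l: "\<And>x y. x < n \<Longrightarrow> y < n \<Longrightarrow> l x y < n" "\<And>x y. x < n \<Longrightarrow> y < n \<Longrightarrow> l' x y < n"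
    and ij: "i < n * (n * q)" "j < n * (n * q)"
  shows "gram (n * (n * q)) (latin_blocks n q K S l) (latin_blocks n q K S l') i j =
    (\<Sum>y<n. if l (i div q mod n) y = l' (j div q mod n) y \<and> i mod q = j mod q
      then K (i div q div n) y * K (j div q div n) y * real (n * q) else 0)"
proof -
  note b = index_bounds[OF ij(1)] index_bounds[OF ij(2)]
  define k k' where "k y = l (i div q mod n) y * q + i mod q"
    and "k' y = l' (j div q mod n) y * q + j mod q" for y
  have "gram (n * (n * q)) (latin_blocks n q K S l) (latin_blocks n q K S l') i j =
      (\<Sum>h<n * (n * q). K (i div q div n) (h div (n * q)) * S (k (h div (n * q))) (h mod (n * q)) *
        (K (j div q div n) (h div (n * q)) * S (k' (h div (n * q))) (h mod (n * q))))"
    by (simp add: gram_def latin_blocks_def k_def k'_def)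
  also have "\<dots> = (\<Sum>y<n. \<Sum>w<n * q. K (i div q div n) y * S (k y) w * (K (j div q div n) y * S (k' y) w))"
    by (rule sum_div_mod)
  also have "\<dots> = (\<Sum>y<n. K (i div q div n) y * K (j div q div n) y * gram (n * q) S S (k y) (k' y))"
    by (simp add: gram_def sum_distrib_left mult_ac)
  also have "\<dots> = (\<Sum>y<n. if l (i div q mod n) y = l' (j div q mod n) y \<and> i mod q = j mod q
      then K (i div q div n) y * K (j div q div n) y * real (n * q) else 0)"
  proof (intro sum.cong refl)
    fix y assume "y \<in> {..<n}"
    then have "k y < n * q" "k' y < n * q"
      using b l by (auto simp: k_def k'_def intro!: chunk_bound)
    then have "gram (n * q) S S (k y) (k' y) = (if k y = k' y then real (n * q) else 0)"
      using S by (simp add: hadamard_matrix_iff)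
    also have "k y = k' y \<longleftrightarrow> l (i div q mod n) y = l' (j div q mod n) y \<and> i mod q = j mod q"
      unfolding k_def k'_def using b by (intro mult_add_eq_iff)
    finally show "K (i div q div n) y * K (j div q div n) y * gram (n * q) S S (k y) (k' y) =
      (if l (i div q mod n) y = l' (j div q mod n) y \<and> i mod q = j mod q
      then K (i div q div n) y * K (j div q div n) y * real (n * q) else 0)" by simp
  qed
  finally show ?thesis .
qed

text \<open>By injectivity, equal chunks in any block column force equal block rows; orthogonality
  of the rows of \<open>K\<close> does the rest.\<close>

lemma hadamard_matrix_latin_blocks:
  assumes l: "\<And>x y. x < n \<Longrightarrow> y < n \<Longrightarrow> l x y < n"
    and inj: "\<And>x x' y. \<lbrakk>x < n; x' < n; y < n; l x y = l x' y\<rbrakk> \<Longrightarrow> x = x'"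
  shows "hadamard_matrix (n * (n * q)) (latin_blocks n q K S l)"
  unfolding hadamard_matrix_iff
proof (intro conjI allI impI)
  fix i j assume ij: "i < n * (n * q)" "j < n * (n * q)"
  note b = index_bounds[OF ij(1)] index_bounds[OF ij(2)]
  have j: "j div (n * q) < n" "j mod (n * q) < n * q"
    using ij by (auto simp: less_mult_imp_div_less intro!: mod_less_divisor intro: gr0I)
  have "K (i div q div n) (j div (n * q)) \<in> {1, -1}"
    using K b j by (simp add: hadamard_matrix_def)
  moreover have "S (l (i div q mod n) (j div (n * q)) * q + i mod q) (j mod (n * q)) \<in> {1, -1}"
    using S j chunk_bound[OF l[OF b(2) j(1)] b(3)] by (simp add: hadamard_matrix_def)
  ultimately show "latin_blocks n q K S l i j \<in> {1, -1}"
    by (auto simp: latin_blocks_def)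
  have eq: "i = j \<longleftrightarrow> i div q div n = j div q div n \<and> i div q mod n = j div q mod n \<and> i mod q = j mod q"
    by (metis div_mult_mod_eq)
  have "gram (n * (n * q)) (latin_blocks n q K S l) (latin_blocks n q K S l) i j =
      (\<Sum>y<n. if l (i div q mod n) y = l (j div q mod n) y \<and> i mod q = j mod q
      then K (i div q div n) y * K (j div q div n) y * real (n * q) else 0)"
    by (rule gram_latin_blocks) (use l ij in blast)+
  also have "\<dots> =
     (\<Sum>y<n. if i div q mod n = j div q mod n \<and> i mod q = j mod q
      then K (i div q div n) y * K (j div q div n) y * real (n * q) else 0)"
    using inj[OF b(2) b(5)] by (intro sum.cong refl) auto
  also have "\<dots> = (if i div q mod n = j div q mod n \<and> i mod q = j mod q
      then gram n K K (i div q div n) (j div q div n) * real (n * q) else 0)"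
    by (auto simp: gram_def sum_distrib_right)
  also have "\<dots> = (if i = j then real (n * (n * q)) else 0)"
    using K b by (auto simp: hadamard_matrix_iff eq)
  finally show "gram (n * (n * q)) (latin_blocks n q K S l) (latin_blocks n q K S l) i j =
    (if i = j then real (n * (n * q)) else 0)" .
qed

text \<open>Only one block column can contribute, and its term is a product of two signs times
  \<open>n * q\<close>.\<close>

lemma gram_latin_blocks_transversal:
  assumes l: "\<And>x y. x < n \<Longrightarrow> y < n \<Longrightarrow> l x y < n" "\<And>x y. x < n \<Longrightarrow> y < n \<Longrightarrow> l' x y < n"
    and meet: "\<And>x x'. x < n \<Longrightarrow> x' < n \<Longrightarrow> \<exists>y<n. \<forall>y'<n. l x y' = l' x' y' \<longleftrightarrow> y' = y"
    and ij: "i < n * (n * q)" "j < n * (n * q)"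
  shows "gram (n * (n * q)) (latin_blocks n q K S l) (latin_blocks n q K S l') i j
    \<in> {0, real (n * q), - real (n * q)}"
proof -
  note b = index_bounds[OF ij(1)] index_bounds[OF ij(2)]
  obtain y where y: "y < n" "\<And>y'. y' < n \<Longrightarrow> l (i div q mod n) y' = l' (j div q mod n) y' \<longleftrightarrow> y' = y"
    using meet[OF b(2) b(5)] by blast
  have "gram (n * (n * q)) (latin_blocks n q K S l) (latin_blocks n q K S l') i j =
      (\<Sum>y<n. if l (i div q mod n) y = l' (j div q mod n) y \<and> i mod q = j mod q
      then K (i div q div n) y * K (j div q div n) y * real (n * q) else 0)"
    by (rule gram_latin_blocks) (use l ij in blast)+
  also have "\<dots> =
     (\<Sum>y'<n. if y' = y then if i mod q = j mod q
      then K (i div q div n) y * K (j div q div n) y * real (n * q) else 0 else 0)"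
    using y(2) by (intro sum.cong refl) auto
  also have "\<dots> = (if i mod q = j mod q
      then K (i div q div n) y * K (j div q div n) y * real (n * q) else 0)"
    using y(1) by simp
  finally have "gram (n * (n * q)) (latin_blocks n q K S l) (latin_blocks n q K S l') i j =
    (if i mod q = j mod q then K (i div q div n) y * K (j div q div n) y * real (n * q) else 0)" .
  moreover have "K (i div q div n) y \<in> {1, -1}" "K (j div q div n) y \<in> {1, -1}"
    using K b y(1) by (simp_all add: hadamard_matrix_def)
  ultimately show ?thesis by auto
qed

end

section \<open>All primes, and the final parameters\<close>

lemma ex_hadamard_matrix_prime:
  assumes "prime q"
  shows "\<exists>t>0. \<exists>H. hadamard_matrix (2 ^ t * q) H"
proof (cases "odd q")
  case True
  then show ?thesis using assms ex_hadamard_matrix_odd_prime by blast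
next
  case False
  then have "q = 2" using assms prime_odd_nat[of q] prime_ge_2_nat[of q] by fastforce
  \<comment> \<open>For \<open>q = 2\<close> the order \<open>2 ^ 1 * q\<close> is 4.\<close>
  then show ?thesis using ex_hadamard_matrix_power_2[of 2] by (intro exI[of _ 1]) simp
qed

theorem theorem4p15:
  fixes q :: nat
  assumes "prime q"
  shows "\<exists>t::nat. t > 0 \<and>
    (\<exists>H :: nat \<Rightarrow> nat \<Rightarrow> nat \<Rightarrow> real.
       (\<forall>i<2^t. hadamard_matrix (2^(2*t) * q) (H i)) \<and>
       (\<forall>i<2^t. \<forall>j<2^t. i \<noteq> j \<longrightarrow>
          quasi_unbiased (2^(2*t) * q) (2^(2*t) * q) (2^(2*t)) (2^(2*t) * q^2) (H i) (H j)))"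
proof -
  obtain t S where t: "t > 0" and S: "hadamard_matrix (2 ^ t * q) S"
    using ex_hadamard_matrix_prime[OF assms] by blast
  obtain K where K: "hadamard_matrix (2 ^ t) K" using ex_hadamard_matrix_power_2 by blast
  define n where "n = (2::nat) ^ t"
  obtain L :: "nat \<Rightarrow> nat \<Rightarrow> nat \<Rightarrow> nat" where
    L: "\<And>a x y. a < n \<Longrightarrow> x < n \<Longrightarrow> y < n \<Longrightarrow> L a x y < n"
    and inj: "\<And>a x x' y. \<lbrakk>a < n; x < n; x' < n; y < n; L a x y = L a x' y\<rbrakk> \<Longrightarrow> x = x'"
    and meet: "\<And>a b x x'. \<lbrakk>a < n; b < n; a \<noteq> b; x < n; x' < n\<rbrakk> \<Longrightarrow>
      \<exists>y<n. \<forall>y'<n. L a x y' = L b x' y' \<longleftrightarrow> y' = y"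
    using ex_latin_family[OF t n_def] by blast
  have q: "q > 0" using assms by (rule prime_gt_0_nat)
  have n0: "n > 0" by (simp add: n_def)
  note KS = q K[folded n_def] S[folded n_def]
  define H where "H a = latin_blocks n q K S (L a)" for a
  have n2: "2 ^ (2 * t) = n ^ 2" by (simp add: n_def power_even_eq)
  then have N: "2 ^ (2 * t) * q = n * (n * q)" by (simp add: power2_eq_square)
  have had: "hadamard_matrix (n * (n * q)) (H a)" if "a < n" for a
    unfolding H_def by (rule hadamard_matrix_latin_blocks[OF KS]) (use L inj that in blast)+
  \<comment> \<open>The scaling is by \<open>d = n * q\<close>, so
    \<open>d ^ 2 = n ^ 2 * q ^ 2\<close>; the order is \<open>n * d\<close>, which leaves weight
    \<open>n ^ 2\<close>.\<close>
  have qu: "quasi_unbiased (n * (n * q)) (n * (n * q)) (n ^ 2) (n ^ 2 * q ^ 2) (H a) (H b)"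
    if ab: "a < n" "b < n" "a \<noteq> b" for a b
    unfolding power_mult_distrib [symmetric]
  proof (rule quasi_unbiasedI[OF had had])
    show "(n * q) ^ 2 * n ^ 2 = (n * (n * q)) ^ 2" by (simp add: power_mult_distrib)
    show "gram (n * (n * q)) (H a) (H b) i j \<in> {0, real (n * q), - real (n * q)}"
      if "i < n * (n * q)" "j < n * (n * q)" for i j
      unfolding H_def
      by (rule gram_latin_blocks_transversal[OF KS]) (use L meet ab that in blast)+
  qed (use ab q n0 in simp_all)
  have "(\<forall>i<2^t. hadamard_matrix (2^(2*t) * q) (H i)) \<and>
    (\<forall>i<2^t. \<forall>j<2^t. i \<noteq> j \<longrightarrow>
      quasi_unbiased (2^(2*t) * q) (2^(2*t) * q) (2^(2*t)) (2^(2*t) * q^2) (H i) (H j))"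
    unfolding N unfolding n2 unfolding n_def [symmetric] using had qu by blast
  then show ?thesis using t by blast
qed

end
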